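(* Let $\Phi=\{\alpha_1,\dots,\alpha_r\}$ be a finite set of linear maps $\alpha_i\colon V\to\mathbb{C}$ with $\alpha_i(\Lambda)\subset\mathbb{Z}$ for all $i$. Let $\mathrm{Adm}(\Phi)\subset\mathbb{T}$ be the set of $\Phi$-admissible elements and $\mathrm{NonAdm}(\Phi)=\mathbb{T}\setminus\mathrm{Adm}(\Phi)$. Then $$\mathrm{Adm}(\Phi)=\bigsqcup_{S\subset\Phi}\ \bigsqcup_{\substack{u\in C(S)\text{ such that some }t\in\mathbb{T}(S)^\circ_u\\ \text{is }\Phi\text{-admissible}}}\mathbb{T}(S)^\circ_u,$$ and $$\mathrm{NonAdm}(\Phi)=\bigsqcup_{S\subset\Phi}\ \bigsqcup_{\substack{u\in C(S)\text{ such that some }t\in\mathbb{T}(S)^\circ_u\\ \text{is not }\Phi\text{-admissible}}}\mathbb{T}(S)^\circ_u=\bigcup_{S\subset\Phi}\ \bigcup_{\substack{u\in C(S)\text{ such that some }t\in\mathbb{T}(S)^\circ_u\\ \text{is not }\Phi\text{-admissible}}}\mathbb{T}(S)_u .$$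
   Context: $V\cong\mathbb{C}^n$ is a complex vector space, $\mathbb{T}\cong(\mathbb{C}^* )^n$ is a complex torus, and $\mathrm{Exp}\colon V\to\mathbb{T}$ is the map given coordinatewise by $z\mapsto\exp(2\pi\sqrt{-1}\,z)$. $\Lambda=\ker(\mathrm{Exp})\cong\mathbb{Z}^n$. For each linear map $\alpha\in\Phi$, $\tilde\alpha\colon\mathbb{T}\to\mathbb{C}^*$ is the unique character with $\tilde\alpha(\mathrm{Exp}(v))=\exp(2\pi\sqrt{-1}\,\alpha(v))$ for all $v\in V$. An element $t\in\mathbb{T}$ is $\Phi$-admissible if there exists $v\in V$ with $\mathrm{Exp}(v)=t$ and $\alpha(v)\notin\mathbb{Z}_{>0}$ for all $\alpha\in\Phi$. For a subset $S\subset\Phi$: $\mathbb{T}(S)=\{t\in\mathbb{T}\mid\tilde\alpha(t)=1\ \forall\alpha\in S\}$ and $\mathbb{T}(S)^\circ=\{t\in\mathbb{T}\mid\tilde\alpha(t)=1\ \forall\alpha\in S,\ \tilde\alpha(t)\ne1\ \forall\alpha\in\Phi\setminus S\}$. $\mathbb{T}(S)_1$ is the identity component of the (possibly disconnected) group $\mathbb{T}(S)$, $C(S)=\mathbb{T}(S)/\mathbb{T}(S)_1$ is its group of components, $\mathbb{T}(S)_u$ is the connected component corresponding to $u\in C(S)$, and $\mathbb{T}(S)^\circ_u=\mathbb{T}(S)_u\cap\mathbb{T}(S)^\circ$. *)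

theory Defs
  imports "HOL-Analysis.Analysis" "HOL-Algebra.Coset"
begin

text \<open>\<open>V\<close> is the type \<open>complex ^ 'n\<close>. The componentwise product and unit on this type give the
  group structure of \<open>(\<complex>\<^sup>*)\<^sup>n\<close>; its topology is the subspace topology.\<close>

definition torus :: "(complex ^ 'n) set"
  where "torus = {t. \<forall>i. t $ i \<noteq> 0}"

definition torus_group :: "(complex ^ 'n) monoid"
  where "torus_group = \<lparr>carrier = torus, mult = (*), one = 1\<rparr>"

definition cstar_group :: "complex monoid"
  where "cstar_group = \<lparr>carrier = - {0}, mult = (*), one = 1\<rparr>"

definition Exp :: "complex ^ 'n \<Rightarrow> complex ^ 'n"
  where "Exp v = (\<chi> i. exp (2 * of_real pi * \<i> * v $ i))"

definition Lattice :: "(complex ^ 'n) set"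
  where "Lattice = {v. Exp v = 1}"

text \<open>The class-based predicate \<open>linear\<close> is only real linearity.\<close>

abbreviation clinear_form :: "(complex ^ 'n \<Rightarrow> complex) \<Rightarrow> bool"
  where "clinear_form \<equiv> Vector_Spaces.linear (*s) (*)"

text \<open>Characters are the holomorphic group homomorphisms to \<open>\<complex>\<^sup>*\<close>, where holomorphic means that
  the Frechet derivative is complex linear at every point of the torus. They are taken to be
  \<open>extensional\<close>, i.e. undefined outside the torus, so that they are determined as HOL functions.\<close>

definition torus_characters :: "(complex ^ 'n \<Rightarrow> complex) set"
  where "torus_characters =
    {\<xi> \<in> hom torus_group cstar_group \<inter> extensional torus.
       \<forall>t\<in>torus. \<exists>D. clinear_form D \<and> (\<xi> has_derivative D) (at t)}"

definition character_of :: "(complex ^ 'n \<Rightarrow> complex) \<Rightarrow> (complex ^ 'n \<Rightarrow> complex)"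
  where "character_of \<alpha> = (THE \<xi>. \<xi> \<in> torus_characters \<and>
    (\<forall>v. \<xi> (Exp v) = exp (2 * of_real pi * \<i> * \<alpha> v)))"

definition admissible :: "(complex ^ 'n \<Rightarrow> complex) set \<Rightarrow> complex ^ 'n \<Rightarrow> bool"
  where "admissible \<Phi> t \<longleftrightarrow> t \<in> torus \<and>
    (\<exists>v. Exp v = t \<and> (\<forall>\<alpha>\<in>\<Phi>. \<alpha> v \<notin> {of_int k |k. k > 0}))"

definition Adm :: "(complex ^ 'n \<Rightarrow> complex) set \<Rightarrow> (complex ^ 'n) set"
  where "Adm \<Phi> = {t \<in> torus. admissible \<Phi> t}"

definition NonAdm :: "(complex ^ 'n \<Rightarrow> complex) set \<Rightarrow> (complex ^ 'n) set"
  where "NonAdm \<Phi> = torus - Adm \<Phi>"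

definition TS :: "(complex ^ 'n \<Rightarrow> complex) set \<Rightarrow> (complex ^ 'n) set"
  where "TS S = {t \<in> torus. \<forall>\<alpha>\<in>S. character_of \<alpha> t = 1}"

definition TS_open ::
  "(complex ^ 'n \<Rightarrow> complex) set \<Rightarrow> (complex ^ 'n \<Rightarrow> complex) set \<Rightarrow> (complex ^ 'n) set"
  where "TS_open \<Phi> S =
    {t \<in> torus. (\<forall>\<alpha>\<in>S. character_of \<alpha> t = 1) \<and> (\<forall>\<alpha>\<in>\<Phi> - S. character_of \<alpha> t \<noteq> 1)}"

definition TS_group :: "(complex ^ 'n \<Rightarrow> complex) set \<Rightarrow> (complex ^ 'n) monoid"
  where "TS_group S = torus_group\<lparr>carrier := TS S\<rparr>"

definition TS_id_comp :: "(complex ^ 'n \<Rightarrow> complex) set \<Rightarrow> (complex ^ 'n) set"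
  where "TS_id_comp S = connected_component_set (TS S) 1"

definition comp_group :: "(complex ^ 'n \<Rightarrow> complex) set \<Rightarrow> (complex ^ 'n) set monoid"
  where "comp_group S = TS_group S Mod TS_id_comp S"

text \<open>The component corresponding to \<open>u\<close> is the one that the projection onto the quotient group
  maps to \<open>u\<close>.\<close>

definition TS_comp ::
  "(complex ^ 'n \<Rightarrow> complex) set \<Rightarrow> (complex ^ 'n) set \<Rightarrow> (complex ^ 'n) set"
  where "TS_comp S u = (THE K. K \<in> components (TS S) \<and>
    (\<forall>t\<in>K. TS_id_comp S #>\<^bsub>TS_group S\<^esub> t = u))"

definition TS_comp_open :: "(complex ^ 'n \<Rightarrow> complex) set \<Rightarrow> (complex ^ 'n \<Rightarrow> complex) set
    \<Rightarrow> (complex ^ 'n) set \<Rightarrow> (complex ^ 'n) set"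
  where "TS_comp_open \<Phi> S u = TS_comp S u \<inter> TS_open \<Phi> S"

lemma Exp_in_torus [simp]: "Exp v \<in> torus"
  by (simp add: Exp_def torus_def)

lemma Exp_surj:
  assumes "t \<in> torus"
  obtains v where "Exp v = t"
proof
  show "Exp (\<chi> i. Ln (t $ i) / (2 * of_real pi * \<i>)) = t"
    using assms by (simp add: Exp_def torus_def vec_eq_iff)
qed

lemma Exp_add: "Exp (v + w) = Exp v * Exp w"
  by (simp add: Exp_def vec_eq_iff distrib_left exp_add)

lemma Exp_axis_mem_Lattice: "axis i 1 \<in> Lattice"
  by (simp add: Exp_def Lattice_def vec_eq_iff axis_def exp_eq_1)

lemma clinear_form_eq_sum:
  fixes \<alpha> :: "complex ^ 'n \<Rightarrow> complex"
  assumes "clinear_form \<alpha>"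
  shows "\<alpha> v = (\<Sum>i\<in>UNIV. v $ i * \<alpha> (axis i 1))"
proof -
  interpret Vector_Spaces.linear "(*s)" "(*)" \<alpha> by fact
  have "\<alpha> v = \<alpha> (\<Sum>i\<in>UNIV. v $ i *s axis i 1)"
    by (simp add: basis_expansion)
  also have "\<dots> = (\<Sum>i\<in>UNIV. v $ i * \<alpha> (axis i 1))"
    by (simp add: sum scale)
  finally show ?thesis .
qed

lemma clinear_form_sum:
  "clinear_form (\<lambda>v. \<Sum>i\<in>UNIV. c i * v $ i)"
  by unfold_locales (simp_all add: algebra_simps sum.distrib sum_distrib_left)

lemma has_derivative_monomial:
  fixes m :: "'n::finite \<Rightarrow> int" and t :: "complex ^ 'n"
  assumes "t \<in> torus"
  shows "\<exists>D. clinear_form D \<and> ((\<lambda>t. \<Prod>i\<in>UNIV. t $ i powi m i) has_derivative D) (at t)"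
proof -
  have "((\<lambda>t. t $ i powi m i) has_derivative
      (\<lambda>h. h $ i * (of_int (m i) * (t $ i) powi (m i - 1)))) (at t)" for i
    using assms
    by (intro has_derivative_power_int bounded_linear.has_derivative[OF bounded_linear_vec_nth]
       has_derivative_ident) (auto simp: torus_def)
  then have "((\<lambda>t. \<Prod>i\<in>UNIV. t $ i powi m i) has_derivative
      (\<lambda>h. \<Sum>i\<in>UNIV. h $ i * (of_int (m i) * (t $ i) powi (m i - 1)) *
        (\<Prod>j\<in>UNIV - {i}. t $ j powi m j))) (at t)"
    by (intro has_derivative_prod) auto
  note der = this
  define c where "c i = of_int (m i) * (t $ i) powi (m i - 1) * (\<Prod>j\<in>UNIV - {i}. t $ j powi m j)"
    for i
  have "((\<lambda>t. \<Prod>i\<in>UNIV. t $ i powi m i) has_derivative (\<lambda>h. \<Sum>i\<in>UNIV. c i * h $ i)) (at t)"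
    by (rule has_derivative_eq_rhs[OF der], intro ext sum.cong refl)
      (simp only: c_def mult.assoc mult.commute mult.left_commute)
  then show ?thesis
    using clinear_form_sum[of c] by (intro exI[of _ "\<lambda>h. \<Sum>i\<in>UNIV. c i * h $ i"] conjI)
qed

lemma open_torus: "open (torus :: (complex ^ 'n) set)"
proof -
  have eq: "torus = (\<Inter>i. {t :: complex ^ 'n. t $ i \<noteq> 0})"
    by (auto simp: torus_def)
  have "open {t :: complex ^ 'n. t $ i \<noteq> 0}" for i
    by (intro open_Collect_neq continuous_intros)
  then show ?thesis
    unfolding eq by (rule open_INT[OF finite_class.finite_UNIV, OF ballI])
qed

proposition ex1_character_of:
  fixes \<alpha> :: "complex ^ 'n \<Rightarrow> complex"
  assumes "clinear_form \<alpha>" and "\<alpha> ` Lattice \<subseteq> \<int>"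
  shows "\<exists>!\<xi>. \<xi> \<in> torus_characters \<and> (\<forall>v. \<xi> (Exp v) = exp (2 * of_real pi * \<i> * \<alpha> v))"
proof (rule ex_ex1I)
  have "\<alpha> (axis i 1) \<in> \<int>" for i
    using assms(2) Exp_axis_mem_Lattice[of i] by blast
  then have "\<forall>i. \<exists>k. \<alpha> (axis i 1) = of_int k"
    unfolding Ints_def by blast
  then obtain m where m: "\<And>i. \<alpha> (axis i 1) = of_int (m i)"
    by metis
  define \<xi> where "\<xi> = restrict (\<lambda>t. \<Prod>i\<in>UNIV. t $ i powi m i) torus"
  have hom: "\<xi> \<in> hom torus_group cstar_group"
    by (auto simp: hom_def torus_group_def cstar_group_def \<xi>_def torus_def power_int_mult_distrib
        prod.distrib)
  have der: "\<exists>D. clinear_form D \<and> (\<xi> has_derivative D) (at t)" if t: "t \<in> torus" for t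
  proof -
    obtain D where D: "clinear_form D"
      "((\<lambda>t. \<Prod>i\<in>UNIV. t $ i powi m i) has_derivative D) (at t)"
      using has_derivative_monomial[OF t] by blast
    have "(\<xi> has_derivative D) (at t)"
      by (rule has_derivative_transform_within_open[OF D(2) open_torus t]) (simp add: \<xi>_def)
    with D(1) show ?thesis by blast
  qed
  have "\<xi> (Exp v) = exp (2 * of_real pi * \<i> * \<alpha> v)" for v
  proof -
    have "\<xi> (Exp v) = (\<Prod>i\<in>UNIV. exp (2 * of_real pi * \<i> * v $ i) powi m i)"
      by (simp add: \<xi>_def Exp_def torus_def)
    also have "\<dots> = (\<Prod>i\<in>UNIV. exp (2 * of_real pi * \<i> * (v $ i * of_int (m i))))"
      by (simp add: exp_power_int mult_ac)
    also have "\<dots> = exp (2 * of_real pi * \<i> * \<alpha> v)"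
      by (simp add: clinear_form_eq_sum[OF assms(1), of v] m exp_sum sum_distrib_left)
    finally show ?thesis .
  qed
  with hom der show "\<exists>\<xi>. \<xi> \<in> torus_characters \<and>
      (\<forall>v. \<xi> (Exp v) = exp (2 * of_real pi * \<i> * \<alpha> v))"
    by (intro exI[of _ \<xi>]) (auto simp: torus_characters_def \<xi>_def)
next
  fix \<xi> \<psi> :: "complex ^ 'n \<Rightarrow> complex"
  assume *: "\<xi> \<in> torus_characters \<and> (\<forall>v. \<xi> (Exp v) = exp (2 * of_real pi * \<i> * \<alpha> v))"
    "\<psi> \<in> torus_characters \<and> (\<forall>v. \<psi> (Exp v) = exp (2 * of_real pi * \<i> * \<alpha> v))"
  show "\<xi> = \<psi>"
  proof (rule extensionalityI)
    show "\<xi> \<in> extensional torus" "\<psi> \<in> extensional torus"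
      using * by (auto simp: torus_characters_def)
    show "\<xi> t = \<psi> t" if "t \<in> torus" for t
      using * Exp_surj[OF that] by metis
  qed
qed

lemma
  fixes \<alpha> :: "complex ^ 'n \<Rightarrow> complex"
  assumes "clinear_form \<alpha>" and "\<alpha> ` Lattice \<subseteq> \<int>"
  shows character_of_mem: "character_of \<alpha> \<in> torus_characters"
    and character_of_Exp: "character_of \<alpha> (Exp v) = exp (2 * of_real pi * \<i> * \<alpha> v)"
  using theI'[OF ex1_character_of[OF assms]] by (auto simp: character_of_def)

lemma group_torus: "Group.group (torus_group :: (complex ^ 'n) monoid)"
proof (rule groupI)
  fix t :: "complex ^ 'n" assume "t \<in> carrier torus_group"
  then show "\<exists>s\<in>carrier torus_group. s \<otimes>\<^bsub>torus_group\<^esub> t = \<one>\<^bsub>torus_group\<^esub>"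
    by (intro bexI[of _ "\<chi> i. inverse (t $ i)"])
      (auto simp: torus_group_def torus_def vec_eq_iff)
qed (auto simp: torus_group_def torus_def mult_ac)

lemma subgroup_TS:
  fixes S :: "(complex ^ 'n \<Rightarrow> complex) set"
  assumes "\<And>\<alpha>. \<alpha> \<in> S \<Longrightarrow> clinear_form \<alpha>" and "\<And>\<alpha>. \<alpha> \<in> S \<Longrightarrow> \<alpha> ` Lattice \<subseteq> \<int>"
  shows "subgroup (TS S) torus_group"
proof -
  interpret Group.group torus_group by (rule group_torus)
  have mult: "character_of \<alpha> (s * t) = character_of \<alpha> s * character_of \<alpha> t"
    if "\<alpha> \<in> S" "s \<in> torus" "t \<in> torus" for \<alpha> s t
    using character_of_mem[OF assms[OF that(1)]] that(2,3)
    by (auto simp: torus_characters_def hom_def torus_group_def cstar_group_def)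
  have one: "character_of \<alpha> 1 = 1" if "\<alpha> \<in> S" for \<alpha>
  proof -
    have "Exp 0 = (1 :: complex ^ 'n)" by (simp add: Exp_def vec_eq_iff)
    moreover have "\<alpha> 0 = 0"
      using clinear_form_eq_sum[OF assms(1)[OF that], of 0] by simp
    ultimately show ?thesis
      using character_of_Exp[OF assms[OF that], of 0] by simp
  qed
  show ?thesis
  proof (rule subgroupI)
    show "TS S \<subseteq> carrier torus_group"
      by (auto simp: TS_def torus_group_def)
    show "TS S \<noteq> {}"
      using one by (auto simp: TS_def torus_def intro!: exI[of _ 1])
    show "s \<otimes>\<^bsub>torus_group\<^esub> t \<in> TS S" if "s \<in> TS S" "t \<in> TS S" for s t
      using that mult by (auto simp: TS_def torus_group_def torus_def)
    show "inv\<^bsub>torus_group\<^esub> t \<in> TS S" if "t \<in> TS S" for t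
    proof -
      have t: "t \<in> carrier torus_group" using that by (auto simp: TS_def torus_group_def)
      define s where "s = inv\<^bsub>torus_group\<^esub> t"
      have s: "s \<in> torus" "s * t = 1"
        using inv_closed[OF t] l_inv[OF t] by (auto simp: torus_group_def s_def)
      have "character_of \<alpha> s = 1" if "\<alpha> \<in> S" for \<alpha>
        using mult[OF that s(1), of t] one[OF that] s(2) \<open>t \<in> TS S\<close> that by (auto simp: TS_def)
      with s(1) show ?thesis by (auto simp: TS_def s_def)
    qed
  qed
qed

lemma connected_component_translate:
  fixes A :: "(complex ^ 'n) set"
  assumes "\<And>s. s \<in> A \<Longrightarrow> s * t \<in> A" and "connected_component A x y"
  shows "connected_component A (x * t) (y * t)"
proof -
  obtain K where K: "connected K" "K \<subseteq> A" "x \<in> K" "y \<in> K"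
    using assms(2) by (auto simp: connected_component_def)
  have "continuous_on K (\<lambda>s. s * t)"
    unfolding times_vec_def by (intro continuous_intros)
  then have "connected ((\<lambda>s. s * t) ` K)"
    using K(1) connected_continuous_image by blast
  then show ?thesis
    unfolding connected_component_def using K assms(1) by blast
qed

lemma TS_coset_eq_component:
  fixes S :: "(complex ^ 'n \<Rightarrow> complex) set"
  assumes "\<And>\<alpha>. \<alpha> \<in> S \<Longrightarrow> clinear_form \<alpha>" and "\<And>\<alpha>. \<alpha> \<in> S \<Longrightarrow> \<alpha> ` Lattice \<subseteq> \<int>"
    and t: "t \<in> TS S"
  shows "TS_id_comp S #>\<^bsub>TS_group S\<^esub> t = connected_component_set (TS S) t"
proof -
  interpret torus: Group.group torus_group by (rule group_torus)
  have sub: "subgroup (TS S) torus_group" using assms(1,2) by (rule subgroup_TS)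
  have mult: "x * y \<in> TS S" if "x \<in> TS S" "y \<in> TS S" for x y
    using subgroup.m_closed[OF sub that] by (simp add: torus_group_def)
  define s where "s = inv\<^bsub>torus_group\<^esub> t"
  have tc: "t \<in> carrier torus_group" using t by (auto simp: TS_def torus_group_def)
  have s: "s \<in> TS S" "s * t = 1" "t * s = 1"
    using subgroup.m_inv_closed[OF sub t] torus.l_inv[OF tc] torus.r_inv[OF tc]
    by (auto simp: s_def torus_group_def)
  have "x \<in> TS_id_comp S #>\<^bsub>TS_group S\<^esub> t" if "connected_component (TS S) t x" for x
  proof -
    have "connected_component (TS S) 1 (x * s)"
      using connected_component_translate[of "TS S" s t x] mult s that by auto
    moreover have "x = (x * s) * t" using s by (simp add: mult.assoc)
    ultimately show ?thesis
      by (auto simp: TS_id_comp_def TS_group_def torus_group_def r_coset_def)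
  qed
  moreover have "connected_component (TS S) t (y * t)"
    if "connected_component (TS S) 1 y" for y
    using connected_component_translate[of "TS S" t 1 y] mult t that by auto
  ultimately show ?thesis
    by (auto simp: TS_id_comp_def TS_group_def torus_group_def r_coset_def)
qed

proposition TS_comp_eq:
  fixes S :: "(complex ^ 'n \<Rightarrow> complex) set"
  assumes "\<And>\<alpha>. \<alpha> \<in> S \<Longrightarrow> clinear_form \<alpha>" and "\<And>\<alpha>. \<alpha> \<in> S \<Longrightarrow> \<alpha> ` Lattice \<subseteq> \<int>"
    and u: "u \<in> carrier (comp_group S)"
  shows "TS_comp S u = u" and "u \<in> components (TS S)"
proof -
  note eq = TS_coset_eq_component[OF assms(1,2)]
  obtain t where t: "t \<in> TS S" "u = connected_component_set (TS S) t"
    using u eq by (auto simp: comp_group_def FactGroup_def RCOSETS_def TS_group_def)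
  show comp: "u \<in> components (TS S)"
    using t by (auto simp: components_def)
  show "TS_comp S u = u"
    unfolding TS_comp_def
  proof (rule the_equality)
    show "u \<in> components (TS S) \<and> (\<forall>t\<in>u. TS_id_comp S #>\<^bsub>TS_group S\<^esub> t = u)"
      using comp eq t by (metis connected_component_eq connected_component_in mem_Collect_eq)
    fix K assume K: "K \<in> components (TS S) \<and> (\<forall>t\<in>K. TS_id_comp S #>\<^bsub>TS_group S\<^esub> t = u)"
    then obtain x where "x \<in> TS S" "K = connected_component_set (TS S) x"
      by (auto simp: components_def)
    with K eq show "K = u"
      by (metis connected_component_refl mem_Collect_eq)
  qed
qed

end

theory Submission
  imports Defs
begin

text \<open>A connected component of \<open>TS S\<close> is a single orbit under the image of the subspace
  \<open>\<Inter>\<alpha>\<in>S. ker \<alpha>\<close>: nearby points of \<open>TS S\<close> differ by \<open>Exp w\<close> with \<open>w\<close> small, and then each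
  \<open>\<alpha> w\<close> is an integer of modulus less than 1. So if \<open>Exp v\<close> and \<open>t\<close> lie in one component,
  then \<open>t = Exp (v + w)\<close> with \<open>\<alpha> (v + w) = \<alpha> v\<close> for all \<open>\<alpha> \<in> S\<close>. If in addition
  \<open>t \<in> TS_open \<Phi> S\<close>, the remaining forms in \<open>\<Phi>\<close> take no integer value at \<open>v + w\<close>; hence
  admissibility of any point of the component passes to \<open>t\<close>.\<close>

lemma exp_two_pi_i_eq_1_iff:
  "exp (2 * of_real pi * \<i> * z) = 1 \<longleftrightarrow> z \<in> \<int>"
proof
  assume "exp (2 * of_real pi * \<i> * z) = 1"
  then obtain n :: int where n: "Re (2 * of_real pi * \<i> * z) = 0"
    "Im (2 * of_real pi * \<i> * z) = of_int (2 * n) * pi"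
    unfolding exp_eq_1 by blast
  have "z = of_int n"
    using n by (simp add: complex_eq_iff)
  then show "z \<in> \<int>" by simp
next
  assume "z \<in> \<int>"
  then obtain n where "z = of_int n" by (auto elim: Ints_cases)
  then show "exp (2 * of_real pi * \<i> * z) = 1"
    by (auto simp: exp_eq_1)
qed

lemma clinear_form_add:
  "clinear_form \<alpha> \<Longrightarrow> \<alpha> (v + w) = \<alpha> v + \<alpha> w"
  using clinear_form_eq_sum[of \<alpha> "v + w"] clinear_form_eq_sum[of \<alpha> v]
    clinear_form_eq_sum[of \<alpha> w] by (simp add: sum.distrib algebra_simps)

lemma clinear_form_minus:
  "clinear_form \<alpha> \<Longrightarrow> \<alpha> (- v) = - \<alpha> v"
  using clinear_form_eq_sum[of \<alpha> "- v"] clinear_form_eq_sum[of \<alpha> v] by (simp add: sum_negf)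

text \<open>Lifted along \<open>Exp\<close>, the multiplicative equations of \<open>TS S\<close>
  become integrality conditions on linear forms, which is where discreteness enters.\<close>

lemma Exp_in_TS_iff:
  assumes "\<And>\<alpha>. \<alpha> \<in> S \<Longrightarrow> clinear_form \<alpha>" and "\<And>\<alpha>. \<alpha> \<in> S \<Longrightarrow> \<alpha> ` Lattice \<subseteq> \<int>"
  shows "Exp v \<in> TS S \<longleftrightarrow> (\<forall>\<alpha>\<in>S. \<alpha> v \<in> \<int>)"
  using assms by (auto simp: TS_def character_of_Exp exp_two_pi_i_eq_1_iff)

text \<open>The translation \<open>w\<close> is the coordinatewise principal logarithm of the
  quotient of \<open>t\<close> by \<open>a\<close>, rescaled to invert \<open>Exp\<close>. It tends
  to 0 as \<open>t\<close> tends to \<open>a\<close>, and finiteness of \<open>S\<close> gives one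
  neighbourhood on which all forms in \<open>S\<close> are small at \<open>w\<close>.\<close>

lemma ex_local_translation_TS:
  fixes S :: "(complex ^ 'n \<Rightarrow> complex) set"
  assumes "finite S"
    and lin: "\<And>\<alpha>. \<alpha> \<in> S \<Longrightarrow> clinear_form \<alpha>" and int: "\<And>\<alpha>. \<alpha> \<in> S \<Longrightarrow> \<alpha> ` Lattice \<subseteq> \<int>"
    and a: "a \<in> TS S"
  shows "\<exists>U. open U \<and> a \<in> U \<and> (\<forall>t\<in>U \<inter> TS S. \<exists>w. (\<forall>\<alpha>\<in>S. \<alpha> w = 0) \<and> t = a * Exp w)"
proof -
  define L where "L t = (\<chi> i. Ln (t $ i / a $ i) / (2 * of_real pi * \<i>))" for t :: "complex ^ 'n"
  have nz: "a $ i \<noteq> 0" for i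
    using a by (auto simp: TS_def torus_def)
  have "((\<lambda>t. t $ i / a $ i) \<longlongrightarrow> a $ i / a $ i) (nhds a)" for i
    using nz by (intro tendsto_intros tendsto_vec_nth filterlim_ident)
  \<comment> \<open>The quotient tends to 1, which lies off the branch cut of
    \<open>Ln\<close>.\<close>
  then have "((\<lambda>t. Ln (t $ i / a $ i)) \<longlongrightarrow> Ln 1) (nhds a)" for i
    using nz by (intro tendsto_Ln) auto
  then have "((\<lambda>t. L t $ i) \<longlongrightarrow> 0) (nhds a)" for i
    using tendsto_divide_zero[of "\<lambda>t. Ln (t $ i / a $ i)"] by (simp add: L_def)
  then have "((\<lambda>t. \<Sum>i\<in>UNIV. L t $ i * \<alpha> (axis i 1)) \<longlongrightarrow> 0) (nhds a)"
    for \<alpha> :: "complex ^ 'n \<Rightarrow> complex"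
    by (intro tendsto_null_sum tendsto_mult_left_zero)
  then have "((\<lambda>t. \<alpha> (L t)) \<longlongrightarrow> 0) (nhds a)" if "\<alpha> \<in> S" for \<alpha>
    by (subst clinear_form_eq_sum[OF lin[OF that]])
  then have "\<forall>\<^sub>F t in nhds a. \<forall>\<alpha>\<in>S. norm (\<alpha> (L t)) < 1"
    using \<open>finite S\<close> by (intro eventually_ball_finite ballI order_tendstoD(2)[of _ 0])
      (auto intro: tendsto_norm_zero)
  then obtain U where U: "open U" "a \<in> U" "\<And>t \<alpha>. t \<in> U \<Longrightarrow> \<alpha> \<in> S \<Longrightarrow> norm (\<alpha> (L t)) < 1"
    unfolding eventually_nhds by blast
  have "(\<forall>\<alpha>\<in>S. \<alpha> (L t) = 0) \<and> t = a * Exp (L t)" if t: "t \<in> U" "t \<in> TS S" for t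
  proof
    have "t \<in> torus" using t by (simp add: TS_def)
    then show t_eq: "t = a * Exp (L t)"
      using nz by (simp add: Exp_def L_def vec_eq_iff torus_def)
    obtain v where v: "Exp v = a"
      using Exp_surj a by (auto simp: TS_def)
    show "\<forall>\<alpha>\<in>S. \<alpha> (L t) = 0"
    proof
      fix \<alpha> assume \<alpha>: "\<alpha> \<in> S"
      \<comment> \<open>Both \<open>v\<close> and \<open>v + L t\<close> lie over points of
        \<open>TS S\<close>, so \<alpha> is integral at each, hence also at their difference
        \<open>L t\<close>.\<close>
      have "\<alpha> v \<in> \<int>"
        using a Exp_in_TS_iff[OF lin int, of S v] \<alpha> v by simp
      moreover have "\<alpha> (v + L t) \<in> \<int>"
        using t Exp_in_TS_iff[OF lin int, of S "v + L t"] \<alpha> v t_eq by (simp add: Exp_add)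
      ultimately have "\<alpha> (L t) \<in> \<int>"
        using clinear_form_add[OF lin[OF \<alpha>], of v "L t"] Ints_diff by fastforce
      with U(3)[OF t(1) \<alpha>] show "\<alpha> (L t) = 0"
        by (auto elim!: Ints_cases)
    qed
  qed
  with U show ?thesis by blast
qed

text \<open>Being translates of each other by \<open>Exp w\<close>, with \<open>w\<close> killed by
  \<open>S\<close>, is an equivalence relation. The local result makes its classes open in
  \<open>TS S\<close>, so a connected subset meets only one class.\<close>

lemma connected_component_TS_translation:
  fixes S :: "(complex ^ 'n \<Rightarrow> complex) set"
  assumes "finite S"
    and lin: "\<And>\<alpha>. \<alpha> \<in> S \<Longrightarrow> clinear_form \<alpha>" and int: "\<And>\<alpha>. \<alpha> \<in> S \<Longrightarrow> \<alpha> ` Lattice \<subseteq> \<int>"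
    and "connected_component (TS S) s t"
  obtains w where "\<And>\<alpha>. \<alpha> \<in> S \<Longrightarrow> \<alpha> w = 0" and "t = s * Exp w"
proof -
  define R where "R s t \<longleftrightarrow> (\<exists>w. (\<forall>\<alpha>\<in>S. \<alpha> w = 0) \<and> t = s * Exp w)" for s t :: "complex ^ 'n"
  obtain K where K: "connected K" "K \<subseteq> TS S" "s \<in> K" "t \<in> K"
    using assms(4) by (auto simp: connected_component_def)
  have "R s t"
  proof (rule connected_equivalence_relation[OF K(1,3,4)])
    fix x y assume "R x y"
    then obtain w where w: "\<forall>\<alpha>\<in>S. \<alpha> w = 0" "y = x * Exp w" by (auto simp: R_def)
    have "Exp w * Exp (- w) = 1"
      by (simp flip: Exp_add) (simp add: Exp_def vec_eq_iff)
    then have "x = y * Exp (- w)"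
      by (simp add: w(2) mult.assoc)
    moreover have "\<alpha> (- w) = 0" if "\<alpha> \<in> S" for \<alpha>
      using clinear_form_minus[OF lin[OF that], of w] bspec[OF w(1) that] by simp
    ultimately show "R y x"
      unfolding R_def by blast
  next
    fix x y z assume "R x y" "R y z"
    then obtain w w' where w: "\<forall>\<alpha>\<in>S. \<alpha> w = 0" "\<forall>\<alpha>\<in>S. \<alpha> w' = 0" "z = x * Exp w * Exp w'"
      by (auto simp: R_def)
    then have "z = x * Exp (w + w')"
      by (simp add: Exp_add mult.assoc)
    moreover have "\<alpha> (w + w') = 0" if "\<alpha> \<in> S" for \<alpha>
      using clinear_form_add[OF lin[OF that], of w w'] bspec[OF w(1) that] bspec[OF w(2) that] by simp
    ultimately show "R x z"
      unfolding R_def by blast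
  next
    fix x assume x: "x \<in> K"
    then obtain U where "open U" "x \<in> U" "\<And>y. y \<in> U \<inter> TS S \<Longrightarrow> R x y"
      using ex_local_translation_TS[OF \<open>finite S\<close> lin int, of x] K(2) unfolding R_def by blast
    \<comment> \<open>Openness is required relative to \<open>K\<close>; points of
      \<open>K \<inter> U\<close> lie in \<open>TS S\<close>, so the local result applies to
      them.\<close>
    with x K(2) show "\<exists>T. openin (top_of_set K) T \<and> x \<in> T \<and> (\<forall>y\<in>T. R x y)"
      by (intro exI[of _ "K \<inter> U"]) (auto simp: openin_open_Int)
  qed
  with that show thesis by (auto simp: R_def)
qed

text \<open>The roles are asymmetric: \<open>s\<close> is any point of the component, while
  \<open>t\<close> lies in the open stratum. Read contrapositively, one non-admissible
  \<open>t\<close> there makes the whole component non-admissible, which yields the union of full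
  components in the description of \<open>NonAdm\<close>.\<close>

lemma admissible_connected_component:
  fixes \<Phi> S :: "(complex ^ 'n \<Rightarrow> complex) set"
  assumes "finite \<Phi>" and lin: "\<And>\<alpha>. \<alpha> \<in> \<Phi> \<Longrightarrow> clinear_form \<alpha>"
    and int: "\<And>\<alpha>. \<alpha> \<in> \<Phi> \<Longrightarrow> \<alpha> ` Lattice \<subseteq> \<int>"
    and "S \<subseteq> \<Phi>" and cc: "connected_component (TS S) s t"
    and "admissible \<Phi> s" and t: "t \<in> TS_open \<Phi> S"
  shows "admissible \<Phi> t"
proof -
  have S: "finite S" "\<And>\<alpha>. \<alpha> \<in> S \<Longrightarrow> clinear_form \<alpha>" "\<And>\<alpha>. \<alpha> \<in> S \<Longrightarrow> \<alpha> ` Lattice \<subseteq> \<int>"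
    using assms finite_subset by auto
  obtain v where v: "Exp v = s" "\<forall>\<alpha>\<in>\<Phi>. \<alpha> v \<notin> {of_int k |k. k > 0}"
    using \<open>admissible \<Phi> s\<close> by (auto simp: admissible_def)
  obtain w where w: "\<And>\<alpha>. \<alpha> \<in> S \<Longrightarrow> \<alpha> w = 0" "t = s * Exp w"
    using connected_component_TS_translation[OF S cc] by blast
  then have t_eq: "Exp (v + w) = t"
    using v by (simp add: Exp_add)
  have "\<alpha> (v + w) \<notin> {of_int k |k. k > 0}" if \<alpha>: "\<alpha> \<in> \<Phi>" for \<alpha>
  proof (cases "\<alpha> \<in> S")
    case True
    then have "\<alpha> (v + w) = \<alpha> v"
      using clinear_form_add[OF lin[OF \<alpha>]] w(1) by simp
    then show ?thesis using v(2) \<alpha> by simp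
  next
    case False
    then have "character_of \<alpha> (Exp (v + w)) \<noteq> 1"
      using t \<alpha> unfolding t_eq by (auto simp: TS_open_def)
    then have "\<alpha> (v + w) \<notin> \<int>"
      by (simp add: character_of_Exp[OF lin int] \<alpha> exp_two_pi_i_eq_1_iff)
    then show ?thesis by auto
  qed
  with t_eq show ?thesis
    unfolding admissible_def using Exp_in_torus by blast
qed

lemma TS_coset_in_comp_group:
  "t \<in> TS S \<Longrightarrow> TS_id_comp S #>\<^bsub>TS_group S\<^esub> t \<in> carrier (comp_group S)"
  by (auto simp: comp_group_def FactGroup_def RCOSETS_def TS_group_def)

theorem theorem2p10:
  fixes \<Phi> :: "(complex ^ 'n \<Rightarrow> complex) set"
  assumes "finite \<Phi>"
    and "\<And>\<alpha>. \<alpha> \<in> \<Phi> \<Longrightarrow> Vector_Spaces.linear (*s) (*) \<alpha>"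
    and "\<And>\<alpha>. \<alpha> \<in> \<Phi> \<Longrightarrow> \<alpha> ` Lattice \<subseteq> \<int>"
  shows
    "Adm \<Phi> = (\<Union>S\<in>Pow \<Phi>. \<Union>u\<in>{u \<in> carrier (comp_group S).
        \<exists>t\<in>TS_comp_open \<Phi> S u. admissible \<Phi> t}. TS_comp_open \<Phi> S u) \<and>
    disjoint_family_on (\<lambda>(S, u). TS_comp_open \<Phi> S u)
      (SIGMA S:Pow \<Phi>. {u \<in> carrier (comp_group S). \<exists>t\<in>TS_comp_open \<Phi> S u. admissible \<Phi> t}) \<and>
    NonAdm \<Phi> = (\<Union>S\<in>Pow \<Phi>. \<Union>u\<in>{u \<in> carrier (comp_group S).
        \<exists>t\<in>TS_comp_open \<Phi> S u. \<not> admissible \<Phi> t}. TS_comp_open \<Phi> S u) \<and>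
    disjoint_family_on (\<lambda>(S, u). TS_comp_open \<Phi> S u)
      (SIGMA S:Pow \<Phi>. {u \<in> carrier (comp_group S). \<exists>t\<in>TS_comp_open \<Phi> S u. \<not> admissible \<Phi> t}) \<and>
    NonAdm \<Phi> = (\<Union>S\<in>Pow \<Phi>. \<Union>u\<in>{u \<in> carrier (comp_group S).
        \<exists>t\<in>TS_comp_open \<Phi> S u. \<not> admissible \<Phi> t}. TS_comp S u)"
proof -
  have lin: "clinear_form \<alpha>" and int: "\<alpha> ` Lattice \<subseteq> \<int>" if "S \<subseteq> \<Phi>" "\<alpha> \<in> S" for S \<alpha>
    using assms(2,3) that by blast+
  \<comment> \<open>An element \<open>u\<close> of the quotient group is a coset and, as a set, is
    itself the component it labels.\<close>
  note comp = TS_comp_eq[OF lin int]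
  let ?C = "\<lambda>S. carrier (comp_group S)"
  have subset: "TS_comp_open \<Phi> S u \<subseteq> TS_comp S u" for S u
    by (simp add: TS_comp_open_def)
  have torus: "TS_comp S u \<subseteq> torus" if "S \<subseteq> \<Phi>" "u \<in> ?C S" for S u
    using comp[OF that(1) _ that(1) _ that(2)] in_components_subset[of u "TS S"]
    by (auto simp: TS_def)
  have cover: "\<exists>S\<in>Pow \<Phi>. \<exists>u\<in>?C S. t \<in> TS_comp_open \<Phi> S u" if t: "t \<in> torus" for t
  proof -
    \<comment> \<open>The stratum of \<open>t\<close> is forced: \<open>S\<close> must collect
      exactly the forms whose character is trivial at \<open>t\<close>.\<close>
    define S where "S = {\<alpha> \<in> \<Phi>. character_of \<alpha> t = 1}"
    define u where "u = TS_id_comp S #>\<^bsub>TS_group S\<^esub> t"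
    have S: "S \<subseteq> \<Phi>" "t \<in> TS S" "t \<in> TS_open \<Phi> S"
      using t by (auto simp: S_def TS_def TS_open_def)
    have u: "u \<in> ?C S"
      unfolding u_def by (rule TS_coset_in_comp_group[OF S(2)])
    have "t \<in> u"
      using TS_coset_eq_component[OF lin int S(2), OF S(1) _ S(1)] S(2) by (simp add: u_def)
    with S u comp(1)[OF S(1) _ S(1) _ u] show ?thesis
      by (auto simp: TS_comp_open_def)
  qed
  have adm: "admissible \<Phi> t"
    if "S \<subseteq> \<Phi>" "u \<in> ?C S" "s \<in> TS_comp S u" "t \<in> TS_comp_open \<Phi> S u" "admissible \<Phi> s"
    for S u s t
  proof (rule admissible_connected_component[OF assms])
    have "s \<in> u" "t \<in> u" "u \<in> components (TS S)"
      using that subset[of S u] comp[OF that(1) _ that(1) _ that(2)] by auto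
    then show "connected_component (TS S) s t"
      by (metis in_components_connected in_components_subset connected_component_def)
    show "t \<in> TS_open \<Phi> S" using that(4) by (simp add: TS_comp_open_def)
  qed (use that in auto)
  \<comment> \<open>Disjointness is shown for all pairs at once; both families in the statement are
    restrictions of this one. A common point determines \<open>S\<close>, and then two components of
    \<open>TS S\<close> that meet coincide.\<close>
  have disj: "disjoint_family_on (\<lambda>(S, u). TS_comp_open \<Phi> S u) (SIGMA S:Pow \<Phi>. ?C S)"
  proof -
    have "S = S' \<and> u = u'"
      if "S \<subseteq> \<Phi>" "u \<in> ?C S" "S' \<subseteq> \<Phi>" "u' \<in> ?C S'"
        "t \<in> TS_comp_open \<Phi> S u" "t \<in> TS_comp_open \<Phi> S' u'" for S u S' u' t
    proof -
      have S: "S = {\<alpha> \<in> \<Phi>. character_of \<alpha> t = 1}" "S' = {\<alpha> \<in> \<Phi>. character_of \<alpha> t = 1}"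
        using that by (auto simp: TS_comp_open_def TS_open_def)
      moreover have "t \<in> u" "u \<in> components (TS S)" "t \<in> u'" "u' \<in> components (TS S')"
        using that subset[of S u] subset[of S' u'] comp[OF that(1) _ that(1) _ that(2)]
          comp[OF that(3) _ that(3) _ that(4)]
        by auto
      ultimately show ?thesis
        using components_eq[of u "TS S" u'] by auto
    qed
    then show ?thesis
      unfolding disjoint_family_on_def by clarsimp blast
  qed
  show ?thesis
  proof (intro conjI)
    have Adm: "Adm \<Phi> = {t \<in> torus. admissible \<Phi> t}"
      and NonAdm: "NonAdm \<Phi> = {t \<in> torus. \<not> admissible \<Phi> t}"
      by (auto simp: NonAdm_def Adm_def)
    show "Adm \<Phi> = (\<Union>S\<in>Pow \<Phi>. \<Union>u\<in>{u \<in> ?C S. \<exists>t\<in>TS_comp_open \<Phi> S u. admissible \<Phi> t}.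
        TS_comp_open \<Phi> S u)" (is "_ = ?R")
    proof
      show "Adm \<Phi> \<subseteq> ?R"
      proof
        fix t assume "t \<in> Adm \<Phi>"
        then have t: "t \<in> torus" "admissible \<Phi> t" by (auto simp: Adm)
        obtain S u where "S \<in> Pow \<Phi>" "u \<in> ?C S" "t \<in> TS_comp_open \<Phi> S u"
          using cover[OF t(1)] by blast
        with t(2) show "t \<in> ?R" by blast
      qed
      \<comment> \<open>One admissible point makes its whole open stratum piece admissible.\<close>
      have "t \<in> Adm \<Phi>"
        if "S \<subseteq> \<Phi>" "u \<in> ?C S" "s \<in> TS_comp_open \<Phi> S u" "admissible \<Phi> s"
          "t \<in> TS_comp_open \<Phi> S u" for S u s t
        using adm[OF that(1,2) _ that(5,4)] subset[of S u] torus[OF that(1,2)] that(3,5)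
        unfolding Adm by blast
      then show "?R \<subseteq> Adm \<Phi>" by clarify
    qed
    \<comment> \<open>The cycle of inclusions \<open>NonAdm \<Phi> \<subseteq> ?R \<subseteq> ?R'
      \<subseteq> NonAdm \<Phi>\<close> gives both descriptions.\<close>
    have 1: "NonAdm \<Phi> \<subseteq> (\<Union>S\<in>Pow \<Phi>. \<Union>u\<in>{u \<in> ?C S. \<exists>t\<in>TS_comp_open \<Phi> S u. \<not> admissible \<Phi> t}.
        TS_comp_open \<Phi> S u)" (is "_ \<subseteq> ?R")
    proof
      fix t assume "t \<in> NonAdm \<Phi>"
      then have t: "t \<in> torus" "\<not> admissible \<Phi> t" by (auto simp: NonAdm)
      obtain S u where "S \<in> Pow \<Phi>" "u \<in> ?C S" "t \<in> TS_comp_open \<Phi> S u"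
        using cover[OF t(1)] by blast
      with t(2) show "t \<in> ?R" by blast
    qed
    have 2: "?R \<subseteq> (\<Union>S\<in>Pow \<Phi>.
        \<Union>u\<in>{u \<in> ?C S. \<exists>t\<in>TS_comp_open \<Phi> S u. \<not> admissible \<Phi> t}. TS_comp S u)" (is "_ \<subseteq> ?R'")
      using subset by blast
    have 3: "?R' \<subseteq> NonAdm \<Phi>"
    proof -
      \<comment> \<open>Here \<open>adm\<close> is used with \<open>s\<close> and \<open>t\<close>
        exchanged: an admissible \<open>t\<close> anywhere in the component would make
        \<open>s\<close> admissible.\<close>
      have "t \<in> NonAdm \<Phi>"
        if "S \<subseteq> \<Phi>" "u \<in> ?C S" "s \<in> TS_comp_open \<Phi> S u" "\<not> admissible \<Phi> s"
          "t \<in> TS_comp S u" for S u s t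
        using adm[OF that(1,2,5,3)] torus[OF that(1,2)] that(4,5) unfolding NonAdm by blast
      then show ?thesis by clarify
    qed
    show "NonAdm \<Phi> = ?R"
      by (rule equalityI[OF 1 order_trans[OF 2 3]])
    show "NonAdm \<Phi> = ?R'"
      by (rule equalityI[OF order_trans[OF 1 2] 3])
  qed (rule disjoint_family_on_mono[OF _ disj], blast)+
qed

end
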